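(* Let $n$ be a positive integer and let $S$ be a semigroup with exactly $n$ minimal left ideals $I_1,I_2,\ldots,I_n$. Let $\gamma(\Gamma(S))$ be the domination number of the intersection ideal graph $\Gamma(S)$. Then: (i) if $S\neq I_1\cup I_2\cup\cdots\cup I_n$, then $\gamma(\Gamma(S))=1$; (ii) if $S=I_1\cup I_2\cup\cdots\cup I_n$, then $\gamma(\Gamma(S))=2$.
   Context: A left ideal of a semigroup $S$ is a non-empty subset $I\subseteq S$ with $SI\subseteq I$; it is nontrivial if $I\neq S$. The intersection of two left ideals is nontrivial if it is non-empty. Minimal left ideals are understood to be nontrivial: a nontrivial left ideal is minimal if it does not properly contain any left ideal of $S$. The intersection ideal graph $\Gamma(S)$ is the simple undirected graph whose vertices are the nontrivial left ideals of $S$, with two distinct vertices $I,J$ adjacent if and only if $I\cap J$ is nontrivial. A dominating set of a graph is a set $D$ of vertices such that every vertex not in $D$ is adjacent to at least one vertex of $D$; the domination number is the minimum size of a dominating set. *)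

theory Defs
  imports "HOL-Library.Extended_Nat"
begin

text \<open>
  The semigroup \<open>S\<close> is an arbitrary type of class \<^class>\<open>semigroup_mult\<close>; as a set it is \<open>UNIV\<close>.
\<close>

definition left_ideal :: "'a::semigroup_mult set \<Rightarrow> bool" where
  "left_ideal I \<longleftrightarrow> I \<noteq> {} \<and> (\<forall>s. \<forall>x\<in>I. s * x \<in> I)"

definition nontrivial_left_ideal :: "'a::semigroup_mult set \<Rightarrow> bool" where
  "nontrivial_left_ideal I \<longleftrightarrow> left_ideal I \<and> I \<noteq> UNIV"

definition minimal_left_ideal :: "'a::semigroup_mult set \<Rightarrow> bool" where
  "minimal_left_ideal I \<longleftrightarrow> nontrivial_left_ideal I \<and> \<not> (\<exists>J. left_ideal J \<and> J \<subset> I)"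

text \<open>
  A simple undirected graph, possibly infinite, is given by its set of vertices and its set of
  edges, each edge being a set of two distinct vertices.
\<close>

type_synonym 'v ugraph = "'v set \<times> 'v set set"

definition verts :: "'v ugraph \<Rightarrow> 'v set" where
  "verts G = fst G"

definition adjacent :: "'v ugraph \<Rightarrow> 'v \<Rightarrow> 'v \<Rightarrow> bool" where
  "adjacent G u v \<longleftrightarrow> {u, v} \<in> snd G"

definition dominating_set :: "'v ugraph \<Rightarrow> 'v set \<Rightarrow> bool" where
  "dominating_set G D \<longleftrightarrow> D \<subseteq> verts G \<and> (\<forall>v \<in> verts G - D. \<exists>u\<in>D. adjacent G v u)"

text \<open>
  Sizes are taken in \<^typ>\<open>enat\<close>, because \<^const>\<open>card\<close> is \<open>0\<close> on infinite sets. The infimum is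
  a minimum: \<^typ>\<open>enat\<close> is well-ordered and the set of all vertices is dominating.
\<close>

definition set_size :: "'v set \<Rightarrow> enat" where
  "set_size D = (if finite D then enat (card D) else \<infinity>)"

definition domination_number :: "'v ugraph \<Rightarrow> enat" where
  "domination_number G = (INF D \<in> {D. dominating_set G D}. set_size D)"

definition intersection_ideal_graph :: "'a::semigroup_mult set ugraph" where
  "intersection_ideal_graph =
    ({I. nontrivial_left_ideal I},
     {{I, J} | I J. nontrivial_left_ideal I \<and> nontrivial_left_ideal J \<and> I \<noteq> J \<and> I \<inter> J \<noteq> {}})"

end

theory Submission
  imports Defs
begin

text \<open>
  If \<open>L\<close> is a minimal left ideal then so is \<open>L x\<close>, unless it is all of \<open>S\<close>. Hence, as soon as one
  minimal left ideal exists, every nontrivial left ideal \<open>J\<close> contains one, namely \<open>L x\<close> for any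
  \<open>x \<in> J\<close>, and so \<open>J\<close> meets the union \<open>U\<close> of the minimal left ideals. If \<open>U \<noteq> S\<close>, then \<open>U\<close> is a
  vertex that dominates the graph. If \<open>U = S\<close>, then for a minimal left ideal \<open>L\<close> the complement of
  \<open>L\<close> is a left ideal, being the union of the other minimal left ideals, and \<open>L\<close> and its complement
  together dominate. No single vertex \<open>K\<close> does: a minimal left ideal not contained in \<open>K\<close> is
  disjoint from \<open>K\<close>.
\<close>

lemma left_ideal_nonempty: "left_ideal I \<Longrightarrow> I \<noteq> {}"
  and left_ideal_mult: "left_ideal I \<Longrightarrow> x \<in> I \<Longrightarrow> s * x \<in> I"
  unfolding left_ideal_def by auto

lemma left_ideal_Int:
  assumes "left_ideal I" "left_ideal J" "I \<inter> J \<noteq> {}"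
  shows "left_ideal (I \<inter> J)"
  using assms unfolding left_ideal_def by auto

lemma left_ideal_Union:
  assumes "\<And>I. I \<in> \<A> \<Longrightarrow> left_ideal I" "\<A> \<noteq> {}"
  shows "left_ideal (\<Union>\<A>)"
  using assms unfolding left_ideal_def by blast

lemma minimal_left_idealD:
  assumes "minimal_left_ideal L"
  shows "left_ideal L" "nontrivial_left_ideal L" "L \<noteq> UNIV"
  using assms unfolding minimal_left_ideal_def nontrivial_left_ideal_def by auto

text \<open>The intersection \<open>L \<inter> J\<close> is a left ideal inside \<open>L\<close>, so
  minimality forces it to be all of \<open>L\<close>.\<close>

lemma minimal_left_ideal_subset:
  assumes "minimal_left_ideal L" "left_ideal J" "L \<inter> J \<noteq> {}"
  shows "L \<subseteq> J"
proof -
  have "left_ideal (L \<inter> J)"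
    using left_ideal_Int minimal_left_idealD(1) assms by blast
  then show ?thesis
    using assms(1) unfolding minimal_left_ideal_def by blast
qed

lemma minimal_left_ideals_disjoint:
  assumes "minimal_left_ideal L" "minimal_left_ideal M" "L \<noteq> M"
  shows "L \<inter> M = {}"
  using assms minimal_left_ideal_subset[of L M] minimal_left_ideal_subset[of M L]
    minimal_left_idealD(1) by blast

text \<open>A left ideal inside \<open>L x\<close> pulls back along right multiplication by
  \<open>x\<close> to a left ideal inside \<open>L\<close>, which by minimality is \<open>L\<close>
  itself. The assumption \<open>ne\<close> is there because minimal left ideals are nontrivial by
  definition.\<close>

lemma minimal_left_ideal_right_translate:
  fixes L :: "'a::semigroup_mult set"
  assumes L: "minimal_left_ideal L" and ne: "(\<lambda>l. l * x) ` L \<noteq> UNIV"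
  shows "minimal_left_ideal ((\<lambda>l. l * x) ` L)"
proof -
  have lL: "left_ideal L"
    by (rule minimal_left_idealD[OF L])
  have "left_ideal ((\<lambda>l. l * x) ` L)"
    using lL unfolding left_ideal_def by (auto simp flip: mult.assoc)
  moreover have "(\<lambda>l. l * x) ` L \<subseteq> K" if K: "left_ideal K" "K \<subseteq> (\<lambda>l. l * x) ` L" for K
  proof -
    let ?P = "{l \<in> L. l * x \<in> K}"
    have "left_ideal ?P"
      using lL K left_ideal_nonempty[OF K(1)] unfolding left_ideal_def
      by (auto simp: mult.assoc)
    then have "L \<subseteq> ?P"
      using L left_ideal_nonempty by (intro minimal_left_ideal_subset) auto
    then show ?thesis by auto
  qed
  ultimately show ?thesis
    using ne unfolding minimal_left_ideal_def nontrivial_left_ideal_def by blast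
qed

lemma nontrivial_left_ideal_contains_minimal:
  fixes L J :: "'a::semigroup_mult set"
  assumes L: "minimal_left_ideal L" and J: "nontrivial_left_ideal J"
  obtains M where "minimal_left_ideal M" "M \<subseteq> J"
proof -
  have lJ: "left_ideal J" "J \<noteq> UNIV"
    using J unfolding nontrivial_left_ideal_def by auto
  then obtain x where "x \<in> J"
    using left_ideal_nonempty by auto
  then have sub: "(\<lambda>l. l * x) ` L \<subseteq> J"
    using left_ideal_mult[OF lJ(1)] by auto
  \<comment> \<open>Lying inside the proper subset \<open>J\<close> excludes the exceptional case
    that \<open>L x\<close> is the whole semigroup.\<close>
  with lJ(2) have "(\<lambda>l. l * x) ` L \<noteq> UNIV"
    by auto
  then show thesis
    using that minimal_left_ideal_right_translate[OF L] sub by blast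
qed

lemma verts_intersection_ideal_graph [simp]:
  "verts intersection_ideal_graph = {I. nontrivial_left_ideal I}"
  unfolding verts_def intersection_ideal_graph_def by simp

lemma adjacent_intersection_ideal_graph:
  "adjacent intersection_ideal_graph I J \<longleftrightarrow>
    nontrivial_left_ideal I \<and> nontrivial_left_ideal J \<and> I \<noteq> J \<and> I \<inter> J \<noteq> {}"
  unfolding adjacent_def intersection_ideal_graph_def by (auto simp: doubleton_eq_iff)

text \<open>The distinctness required by adjacency disappears, since \<open>J \<notin> D\<close> and
  \<open>I \<in> D\<close> already imply it.\<close>

lemma dominating_set_intersection_ideal_graph:
  "dominating_set intersection_ideal_graph D \<longleftrightarrow>
    (\<forall>I\<in>D. nontrivial_left_ideal I) \<and>
    (\<forall>J. nontrivial_left_ideal J \<longrightarrow> J \<notin> D \<longrightarrow> (\<exists>I\<in>D. J \<inter> I \<noteq> {}))"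
  unfolding dominating_set_def verts_intersection_ideal_graph adjacent_intersection_ideal_graph
  by blast

lemma domination_number_eqI:
  assumes "dominating_set G D" "set_size D = k"
    and "\<And>D'. dominating_set G D' \<Longrightarrow> k \<le> set_size D'"
  shows "domination_number G = k"
  unfolding domination_number_def
  using assms by (intro antisym INF_greatest) (auto intro: INF_lower2)

lemma one_le_set_size: "D \<noteq> {} \<Longrightarrow> 1 \<le> set_size D"
  unfolding set_size_def by (auto simp: one_enat_def Suc_le_eq card_gt_0_iff)

lemma two_le_set_size:
  assumes "D \<noteq> {}" "\<And>x. D \<noteq> {x}"
  shows "2 \<le> set_size D"
proof (cases "finite D")
  case True
  then have "card D \<noteq> 0" "card D \<noteq> 1"
    using assms by (auto simp: card_1_singleton_iff)
  then have "2 \<le> card D"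
    by linarith
  then show ?thesis
    using True by (simp add: set_size_def numeral_eq_enat)
qed (simp add: set_size_def)

text \<open>A vertex outside the empty set would need a neighbour in it.\<close>

lemma dominating_set_nonempty:
  assumes "dominating_set G D" "verts G \<noteq> {}"
  shows "D \<noteq> {}"
  using assms unfolding dominating_set_def by auto

lemma domination_number_eq_1:
  assumes L: "minimal_left_ideal (L :: 'a::semigroup_mult set)"
    and U: "\<Union>{M :: 'a set. minimal_left_ideal M} \<noteq> UNIV"
  shows "domination_number (intersection_ideal_graph :: 'a set ugraph) = 1"
proof (rule domination_number_eqI)
  let ?U = "\<Union>{M :: 'a set. minimal_left_ideal M}"
  \<comment> \<open>The given \<open>L\<close> makes the family nonempty, so that its union is a
    left ideal.\<close>
  have nU: "nontrivial_left_ideal ?U"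
    unfolding nontrivial_left_ideal_def
    using L U minimal_left_idealD(1) by (intro conjI left_ideal_Union) auto
  have "J \<inter> ?U \<noteq> {}" if J: "nontrivial_left_ideal J" for J
  proof -
    obtain M where M: "minimal_left_ideal M" "M \<subseteq> J"
      using nontrivial_left_ideal_contains_minimal[OF L J] .
    then show ?thesis
      using left_ideal_nonempty[OF minimal_left_idealD(1)[OF M(1)]] by blast
  qed
  with nU show "dominating_set intersection_ideal_graph {?U}"
    unfolding dominating_set_intersection_ideal_graph by simp
  show "set_size {?U} = 1"
    by (simp add: set_size_def one_enat_def)
  show "1 \<le> set_size D"
    if "dominating_set (intersection_ideal_graph :: 'a set ugraph) D" for D
    by (rule one_le_set_size[OF dominating_set_nonempty[OF that]]) (use nU in auto)
qed

lemma domination_number_eq_2: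
  assumes L: "minimal_left_ideal (L :: 'a::semigroup_mult set)"
    and U: "\<Union>{M :: 'a set. minimal_left_ideal M} = UNIV"
  shows "domination_number (intersection_ideal_graph :: 'a set ugraph) = 2"
proof (rule domination_number_eqI)
  have nL: "nontrivial_left_ideal L"
    by (rule minimal_left_idealD[OF L])
  have cover: "\<exists>M. minimal_left_ideal M \<and> x \<in> M" for x :: 'a
    using U by auto
  \<comment> \<open>By the covering, \<open>x\<close> lies in a minimal left ideal \<open>M\<close>
    other than \<open>L\<close>; it absorbs \<open>s * x\<close> and is disjoint from
    \<open>L\<close>.\<close>
  have "s * x \<in> - L" if "x \<in> - L" for s x
  proof -
    obtain M where M: "minimal_left_ideal M" "x \<in> M"
      using cover by auto
    then have "L \<inter> M = {}"
      using L that by (intro minimal_left_ideals_disjoint) auto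
    moreover have "s * x \<in> M"
      using M by (intro left_ideal_mult minimal_left_idealD(1))
    ultimately show ?thesis
      by auto
  qed
  moreover have "- L \<noteq> {}"
    using minimal_left_idealD(3)[OF L] by auto
  ultimately have "left_ideal (- L)"
    unfolding left_ideal_def by auto
  then have nC: "nontrivial_left_ideal (- L)"
    using left_ideal_nonempty[OF minimal_left_idealD(1)[OF L]]
    unfolding nontrivial_left_ideal_def by auto
  have "J \<inter> L \<noteq> {} \<or> J \<inter> - L \<noteq> {}" if "nontrivial_left_ideal J" for J
  proof -
    have "J \<noteq> {}"
      using that left_ideal_nonempty unfolding nontrivial_left_ideal_def by auto
    then show ?thesis
      by auto
  qed
  with nL nC show "dominating_set intersection_ideal_graph {L, - L}"
    unfolding dominating_set_intersection_ideal_graph by simp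
  have "L \<noteq> - L"
    using left_ideal_nonempty[OF minimal_left_idealD(1)[OF L]] by auto
  then show "set_size {L, - L} = 2"
    by (simp add: set_size_def numeral_eq_enat)
  show "2 \<le> set_size D"
    if D: "dominating_set (intersection_ideal_graph :: 'a set ugraph) D" for D
  proof (rule two_le_set_size)
    show "D \<noteq> {}"
      by (rule dominating_set_nonempty[OF D]) (use nL in auto)
    show "D \<noteq> {K}" for K
    proof
      assume "D = {K}"
      with D have K: "nontrivial_left_ideal K"
        and dom: "\<And>J. nontrivial_left_ideal J \<Longrightarrow> J \<noteq> K \<Longrightarrow> J \<inter> K \<noteq> {}"
        unfolding dominating_set_intersection_ideal_graph by auto
      \<comment> \<open>The point \<open>x\<close> serves twice: it gives
        \<open>M \<noteq> K\<close>, so that \<open>K\<close> must meet \<open>M\<close>, and it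
        contradicts the resulting inclusion \<open>M \<subseteq> K\<close>.\<close>
      obtain x where x: "x \<notin> K"
        using K unfolding nontrivial_left_ideal_def by auto
      obtain M where M: "minimal_left_ideal M" "x \<in> M"
        using cover by auto
      with x have "M \<inter> K \<noteq> {}"
        by (intro dom minimal_left_idealD(2)) auto
      moreover have "left_ideal K"
        using K unfolding nontrivial_left_ideal_def by simp
      ultimately have "M \<subseteq> K"
        by (intro minimal_left_ideal_subset M(1))
      with M(2) x show False
        by auto
    qed
  qed
qed

theorem theorem4p5:
  fixes n :: nat and I :: "nat \<Rightarrow> 'a::semigroup_mult set"
  assumes "n \<ge> 1"
    and "bij_betw I {1..n} {L :: 'a set. minimal_left_ideal L}"
  shows "((UNIV :: 'a set) \<noteq> (\<Union>i\<in>{1..n}. I i) \<longrightarrow>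
            domination_number (intersection_ideal_graph :: 'a set ugraph) = 1)
       \<and> ((UNIV :: 'a set) = (\<Union>i\<in>{1..n}. I i) \<longrightarrow>
            domination_number (intersection_ideal_graph :: 'a set ugraph) = 2)"
proof -
  have img: "I ` {1..n} = {L. minimal_left_ideal L}"
    using assms(2) by (rule bij_betw_imp_surj_on)
  \<comment> \<open>Since \<open>n \<ge> 1\<close>, the index 1 is in range and yields the minimal
    left ideal that both cases start from.\<close>
  with assms(1) have "minimal_left_ideal (I 1)"
    by auto
  then show ?thesis
    using domination_number_eq_1[of "I 1"] domination_number_eq_2[of "I 1"] unfolding img by auto
qed

end
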